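(* Let $g:\mathbb{R}\to\mathbb{R}$ be real-analytic and let $f:\mathcal{F}\to\mathbb{R}^{\mathbb{Z}_{<}}$ be its canonical extension. Then for every finite $\mathbf{x}\in\mathbb{R}^{\mathbb{Z}_{<}}$, $$\operatorname{St}\!\left(\frac{f(\mathbf{x}+\epsilon)-f(\mathbf{x})}{\epsilon}\right)=g'\bigl(\operatorname{St}(\mathbf{x})\bigr).$$
   Context: $\mathbb{R}^{\mathbb{Z}_{<}}$ is the field of all two-sided real sequences $\mathbf{x}=(x_n)_{n\in\mathbb{Z}}$ for which there exists $N$ with $x_n=0$ for all $n<-N$, with componentwise addition and Cauchy convolution $(\mathbf{x}\cdot\mathbf{y})_n=\sum_{k\in\mathbb{Z}}x_k y_{n-k}$. The element $\epsilon$ has entry $1$ at index $1$ and $0$ elsewhere. The valuation is $\operatorname{val}(\mathbf{x})=\min\{n:x_n\ne 0\}$, $\operatorname{val}(0)=\infty$. The field is totally ordered by: $\mathbf{x}<\mathbf{y}$ iff $\mathbf{x}\neq\mathbf{y}$ and $y_n-x_n>0$ for $n=\operatorname{val}(\mathbf{y}-\mathbf{x})$. Reals $r$ are identified with the sequence having $r$ at index $0$ and $0$ elsewhere. $\mathcal{F}$ is the ring of finite elements, i.e. those $\mathbf{x}$ with $|\mathbf{x}|<r$ for some $r\in\mathbb{R}$, and $\operatorname{St}(\mathbf{x})=x_0$ for $\mathbf{x}\in\mathcal{F}$. The valuation topology is the one induced by the ultrametric $d(\mathbf{x},\mathbf{y})=2^{-\operatorname{val}(\mathbf{x}-\mathbf{y})}$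 (with $2^{-\infty}=0$). The canonical extension of a real-analytic $g:\mathbb{R}\to\mathbb{R}$ is the function $f:\mathcal{F}\to\mathbb{R}^{\mathbb{Z}_{<}}$ given by $f(\mathbf{x})=\sum_{k=0}^{\infty}\frac{g^{(k)}(\operatorname{St}(\mathbf{x}))}{k!}\bigl(\mathbf{x}-\operatorname{St}(\mathbf{x})\bigr)^k$, where the series converges in the valuation topology. *)

theory Defs
  imports "HOL-Analysis.Analysis" "HOL-Computational_Algebra.Formal_Laurent_Series"
begin

unbundle fps_syntax

text \<open>
  The field of two-sided real sequences vanishing far to the left, with Cauchy convolution, is the
  library type \<^typ>\<open>real fls\<close> of formal Laurent series. The infinitesimal $\epsilon$ is
  \<^const>\<open>fls_X\<close>, reals are embedded by \<^const>\<open>fls_const\<close>, and the valuation of a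
  nonzero element is \<^const>\<open>fls_subdegree\<close> (which is $0$, not $\infty$, at $0$). The
  metric the library puts on this type is the valuation ultrametric.
\<close>

lemma dist_fls_eq_valuation:
  "dist x y = (if x = y then 0 else 2 powr (- of_int (fls_subdegree (x - y))))"
  for x y :: "real fls"
  by (auto simp: dist_fls_def powr_minus powr_real_of_int' power_int_def nat_eq_iff powr_realpow
      field_simps)

lemma lead_coeff_fls_mult:
  "(x * y) $$ fls_subdegree (x * y) = x $$ fls_subdegree x * y $$ fls_subdegree y"
  for x y :: "'a::linordered_field fls"
proof (cases "x = 0 \<or> y = 0")
  case False
  then show ?thesis
    by (simp add: fls_times_base)
qed auto

lemma lead_coeff_fls_add_pos:
  fixes x y :: "'a::linordered_field fls"
  assumes "x $$ fls_subdegree x > 0" "y $$ fls_subdegree y > 0"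
  shows "(x + y) $$ fls_subdegree (x + y) > 0"
proof -
  define m where "m = min (fls_subdegree x) (fls_subdegree y)"
  have *: "z $$ m \<ge> 0 \<and> (fls_subdegree z = m \<longrightarrow> z $$ m > 0)"
    if "z \<in> {x, y}" for z
    using that assms
    by (cases "fls_subdegree z = m") (auto simp: m_def min_def split: if_splits)
  have "fls_subdegree x = m \<or> fls_subdegree y = m"
    by (auto simp: m_def min_def)
  with *[of x] *[of y] have pos: "(x + y) $$ m > 0"
    by (auto intro: add_pos_nonneg add_nonneg_pos)
  have "fls_subdegree (x + y) = m"
    using pos by (intro fls_subdegree_eqI) (auto simp: m_def)
  with pos show ?thesis by simp
qed

instantiation fls :: (linordered_field) "{ord, abs, sgn}"
begin

definition
  "x < y \<longleftrightarrow> x \<noteq> y \<and>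
     y $$ fls_subdegree (y - x) - x $$ fls_subdegree (y - x) > 0" for x y :: "'a fls"

definition
  "x \<le> y \<longleftrightarrow> x < y \<or> x = y" for x y :: "'a fls"

definition
  "\<bar>x\<bar> = (if x < 0 then - x else x)" for x :: "'a fls"

definition
  "sgn x = (if x = 0 then 0 else if 0 < x then 1 else - 1)" for x :: "'a fls"

instance ..

end

instance fls :: (linordered_field) linordered_field
proof
  fix x y z :: "'a fls"
  have less_iff: "a < b \<longleftrightarrow> (b - a) $$ fls_subdegree (b - a) > 0" for a b :: "'a fls"
    by (auto simp: less_fls_def)
  have trans: "a < c" if "a < b" "b < c" for a b c :: "'a fls"
    using lead_coeff_fls_add_pos[of "c - b" "b - a"] that by (simp add: less_iff)
  have irrefl: "\<not> a < a" for a :: "'a fls"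
    by (simp add: less_fls_def)
  show "(x < y) = (x \<le> y \<and> \<not> y \<le> x)"
    unfolding less_eq_fls_def by (metis trans irrefl)
  show "x \<le> x" by (simp add: less_eq_fls_def)
  show "x \<le> y \<Longrightarrow> y \<le> z \<Longrightarrow> x \<le> z"
    unfolding less_eq_fls_def by (metis trans)
  show "x \<le> y \<Longrightarrow> y \<le> x \<Longrightarrow> x = y"
    unfolding less_eq_fls_def by (metis trans irrefl)
  show "x \<le> y \<or> y \<le> x"
  proof (cases "x = y")
    case False
    then have "(y - x) $$ fls_subdegree (y - x) \<noteq> 0"
      by (simp add: nth_fls_subdegree_nonzero del: fls_minus_nth)
    moreover have "(x - y) $$ fls_subdegree (x - y) = - ((y - x) $$ fls_subdegree (y - x))"
      by (simp add: fls_subdegree_minus_sym)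
    ultimately show ?thesis
      unfolding less_eq_fls_def less_iff by linarith
  qed (simp add: less_eq_fls_def)
  show "x \<le> y \<Longrightarrow> z + x \<le> z + y"
    by (auto simp: less_eq_fls_def less_iff)
  show "x < y \<Longrightarrow> 0 < z \<Longrightarrow> z * x < z * y"
    using lead_coeff_fls_mult[of z "y - x"]
    by (simp add: less_iff right_diff_distrib del: fls_minus_nth)
  show "\<bar>x\<bar> = (if x < 0 then - x else x)" by (simp add: abs_fls_def)
  show "sgn x = (if x = 0 then 0 else if 0 < x then 1 else - 1)" by (simp add: sgn_fls_def)
qed

definition finite_elements :: "real fls set" where
  "finite_elements = {x. \<exists>r. \<bar>x\<bar> < fls_const r}"

text \<open>Meaningful only on \<^const>\<open>finite_elements\<close>.\<close>

definition St :: "real fls \<Rightarrow> real" where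
  "St x = x $$ 0"

definition real_analytic :: "(real \<Rightarrow> real) \<Rightarrow> bool" where
  "real_analytic g \<longleftrightarrow> (\<forall>a. \<exists>F. (\<lambda>h. g (a + h)) has_fps_expansion F)"

text \<open>
  Meaningful only on \<^const>\<open>finite_elements\<close>, where the series converges (shown below).
  The infinite sum refers to the valuation topology.
\<close>

definition canonical_extension :: "(real \<Rightarrow> real) \<Rightarrow> real fls \<Rightarrow> real fls" where
  "canonical_extension g x =
     (\<Sum>k. fls_const ((deriv ^^ k) g (St x) / fact k) * (x - fls_const (St x)) ^ k)"

lemma finite_elements_iff: "x \<in> finite_elements \<longleftrightarrow> (\<forall>n<0. x $$ n = 0)"
proof
  assume "x \<in> finite_elements"
  then obtain r where r: "\<bar>x\<bar> < fls_const r"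
    by (auto simp: finite_elements_def)
  show "\<forall>n<0. x $$ n = 0"
  proof (rule ccontr)
    assume "\<not> (\<forall>n<0. x $$ n = 0)"
    then obtain n where n: "n < 0" "x $$ n \<noteq> 0" by blast
    define m where "m = fls_subdegree x"
    have m: "m < 0" "x $$ m \<noteq> 0"
      using n fls_subdegree_leI[of x n] by (auto simp: m_def nth_fls_subdegree_zero_iff)
    have sub: "fls_subdegree (fls_const r - y) = m" if "y = x \<or> y = - x" for y
      using that m by (intro fls_subdegree_eqI) (auto simp: m_def)
    have "x < fls_const r" "- x < fls_const r"
      using r by (auto simp: abs_less_iff)
    with sub[of x] sub[of "- x"] m show False
      by (auto simp: less_fls_def)
  qed
next
  assume x: "\<forall>n<0. x $$ n = 0"
  define r where "r = \<bar>x $$ 0\<bar> + 1"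
  have "y < fls_const r" if "y = x \<or> y = - x" for y
  proof -
    have pos: "(fls_const r - y) $$ 0 > 0"
      using that by (auto simp: r_def)
    have "fls_subdegree (fls_const r - y) = 0"
      using pos x that by (intro fls_subdegree_eqI) auto
    with pos show ?thesis by (auto simp: less_fls_def)
  qed
  then have "\<bar>x\<bar> < fls_const r" by (simp add: abs_less_iff)
  then show "x \<in> finite_elements" by (auto simp: finite_elements_def)
qed

lemma canonical_extension_sums:
  assumes "x \<in> finite_elements"
  shows "(\<lambda>k. fls_const ((deriv ^^ k) g (St x) / fact k) * (x - fls_const (St x)) ^ k)
           sums canonical_extension g x"
proof -
  define c where "c k = (deriv ^^ k) g (St x) / fact k" for k
  define p where "p = fls_regpart (x - fls_const (St x))"
  have p: "x - fls_const (St x) = fps_to_fls p"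
    using assms by (auto simp: finite_elements_iff p_def fls_eq_iff)
  have p0: "fps_nth p 0 = 0" by (simp add: p_def St_def)
  define P where "P N = (\<Sum>k<N. fps_const (c k) * p ^ k)" for N
  have nth: "fps_nth (fps_compose (Abs_fps c) p) n = fps_nth (P N) n" if "n < N" for n N
  proof -
    have "fps_nth (P N) n = (\<Sum>k<N. c k * fps_nth (p ^ k) n)"
      by (simp add: P_def fps_sum_nth)
    also have "\<dots> = (\<Sum>k=0..n. c k * fps_nth (p ^ k) n)"
      using that p0 by (intro sum.mono_neutral_right) (auto simp: startsby_zero_power_prefix)
    finally show ?thesis by (simp add: fps_compose_nth)
  qed
  have partial: "(\<Sum>k<N. fls_const (c k) * (x - fls_const (St x)) ^ k) = fps_to_fls (P N)" for N
    unfolding P_def p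
    by (induction N)
      (simp_all add: fls_times_fps_to_fls fps_to_fls_power)
  have "(\<lambda>N. fps_to_fls (P N)) \<longlonglongrightarrow> fps_to_fls (fps_compose (Abs_fps c) p)"
  proof (rule metric_LIMSEQ_I)
    fix e :: real
    assume e: "e > 0"
    obtain M where M: "(1 / 2) ^ M < e"
      using real_arch_pow_inv[OF e, of "1 / 2"] by auto
    have "dist (fps_to_fls (P N)) (fps_to_fls (fps_compose (Abs_fps c) p)) < e" if N: "N \<ge> M" for N
    proof (cases "P N = (fps_compose (Abs_fps c) p)")
      case False
      define D where "D = fps_to_fls (P N) - fps_to_fls (fps_compose (Abs_fps c) p)"
      have "D \<noteq> 0" using False by (simp add: D_def)
      moreover have "D $$ n = 0" if "n < int N" for n
        using that nth[of "nat n" N] by (auto simp: D_def)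
      ultimately have "fls_subdegree D \<ge> int N"
        by (intro fls_subdegree_geI) auto
      then have "2 powr (- of_int (fls_subdegree D)) \<le> 2 powr (- real M)"
        using N by (intro powr_mono) auto
      also have "\<dots> = (1 / 2) ^ M"
        by (simp add: powr_minus powr_realpow power_one_over inverse_eq_divide)
      finally show ?thesis
        using M False by (simp add: dist_fls_eq_valuation D_def)
    qed (use e in simp)
    then show "\<exists>M. \<forall>N\<ge>M. dist (fps_to_fls (P N)) (fps_to_fls (fps_compose (Abs_fps c) p)) < e"
      by blast
  qed
  then have "(\<lambda>k. fls_const (c k) * (x - fls_const (St x)) ^ k) sums fps_to_fls (fps_compose (Abs_fps c) p)"
    by (simp add: sums_def partial)
  then show ?thesis
    by (simp add: canonical_extension_def c_def sums_iff)
qed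

end

(*
  The coefficients of a convergent sequence of Laurent series are eventually constant, so the n-th
  coefficient of f(x) is a finite sum over k <= n: powers of the infinitesimal x - St(x) of higher
  order do not reach index n. Hence f(x) = g(St x) + g'(St x) x_1 eps + O(eps^2). Replacing x by
  x + eps leaves St x unchanged and increases x_1 by 1, so the difference is g'(St x) eps + O(eps^2).
*)

theory Submission
  imports Defs
begin

text \<open>Distance less than \<open>2 powr (- n)\<close> means that the difference is 0 or has
  valuation greater than \<open>n\<close>, so its coefficient at \<open>n\<close> vanishes.\<close>

lemma eventually_fls_nth_eq:
  fixes X :: "nat \<Rightarrow> real fls"
  assumes "X \<longlonglongrightarrow> L"
  shows "\<forall>\<^sub>F N in sequentially. X N $$ n = L $$ n"
proof -
  have "\<forall>\<^sub>F N in sequentially. dist (X N) L < 2 powr (- of_int n)"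
    using tendstoD[OF assms] by simp
  then show ?thesis
  proof eventually_elim
    case (elim N)
    then have "X N = L \<or> n < fls_subdegree (X N - L)"
      by (auto simp: dist_fls_eq_valuation split: if_splits)
    then have "(X N - L) $$ n = 0"
      by (auto simp del: fls_minus_nth intro: fls_eq0_below_subdegree)
    then show ?case by simp
  qed
qed

text \<open>Such a \<open>q\<close> is a power series without constant term, so its
  \<open>k\<close>-th power starts at order \<open>k\<close> or later.\<close>

lemma fls_power_nth_eq_0:
  fixes q :: "'a::comm_ring_1 fls"
  assumes "\<And>m. m \<le> 0 \<Longrightarrow> q $$ m = 0" and "n < int k"
  shows "(q ^ k) $$ n = 0"
proof -
  have q: "q = fps_to_fls (fls_regpart q)"
    using assms(1) by (auto simp: fls_eq_iff)
  have "fls_regpart q $ 0 = 0"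
    using assms(1) by simp
  then have "(fls_regpart q ^ k) $ nat n = 0" if "n \<ge> 0"
    using that assms(2) startsby_zero_power_prefix[of "fls_regpart q" k] by simp
  then show ?thesis
    by (subst q) (auto simp flip: fps_to_fls_power)
qed

lemma canonical_extension_nth:
  assumes "x \<in> finite_elements"
  shows "canonical_extension g x $$ n =
    (\<Sum>k\<le>nat n. (deriv ^^ k) g (St x) / fact k * ((x - fls_const (St x)) ^ k) $$ n)"
proof -
  define t where "t k = (deriv ^^ k) g (St x) / fact k * ((x - fls_const (St x)) ^ k) $$ n" for k
  have "\<forall>\<^sub>F N in sequentially. (\<Sum>k<N. t k) = canonical_extension g x $$ n"
    using eventually_fls_nth_eq[OF canonical_extension_sums[OF assms, unfolded sums_def]]
    by (simp add: fls_nth_sum t_def)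
  then obtain M where M: "\<And>N. N \<ge> M \<Longrightarrow> (\<Sum>k<N. t k) = canonical_extension g x $$ n"
    by (auto simp: eventually_sequentially)
  have "t k = 0" if "k > nat n" for k
    using that assms by (auto simp: t_def finite_elements_iff St_def intro!: fls_power_nth_eq_0)
  \<comment> \<open>This cutoff lies past both \<open>M\<close>, where the partial sums have
    stabilized, and \<open>nat n\<close>, after which all terms vanish.\<close>
  then have "(\<Sum>k<M + Suc (nat n). t k) = (\<Sum>k\<le>nat n. t k)"
    by (intro sum.mono_neutral_right) auto
  with M[of "M + Suc (nat n)"] show ?thesis
    by (simp add: t_def)
qed

theorem lemma6p2:
  fixes g :: "real \<Rightarrow> real" and x :: "real fls"
  assumes "real_analytic g" and "x \<in> finite_elements"
  shows "(canonical_extension g (x + fls_X) - canonical_extension g x) / fls_X \<in> finite_elements \<and>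
    St ((canonical_extension g (x + fls_X) - canonical_extension g x) / fls_X) = deriv g (St x)"
proof -
  define D where "D = canonical_extension g (x + fls_X) - canonical_extension g x"
  have fin: "x + fls_X \<in> finite_elements"
    using assms(2) by (simp add: finite_elements_iff)
  have St: "St (x + fls_X) = St x"
    by (simp add: St_def)
  \<comment> \<open>Here \<open>nat n = 0\<close>, also for negative \<open>n\<close>: only the term
    \<open>k = 0\<close> remains, and it depends on \<open>St x\<close> alone, so it
    cancels.\<close>
  have "D $$ n = 0" if "n \<le> 0" for n
    using that by (simp add: D_def canonical_extension_nth assms(2) fin St)
  \<comment> \<open>The terms \<open>k = 0\<close> contribute nothing at index 1; those for
    \<open>k = 1\<close> differ by \<open>deriv g (St x)\<close> times the coefficient 1 of
    \<open>fls_X\<close>.\<close>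
  moreover have "D $$ 1 = deriv g (St x)"
    by (simp add: D_def canonical_extension_nth assms(2) fin St distrib_left)
  moreover have "(D / fls_X) $$ n = D $$ (n + 1)" for n
    by (simp add: fls_divide_X)
  ultimately show ?thesis
    unfolding D_def[symmetric] by (simp add: finite_elements_iff St_def)
qed

end
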